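(* In $S_\infty$, for all $A,B\in\mathrm{ClForm}$ (writing $\models^A$, $\models^V$ for $\models^A_{S_\infty}$, $\models^V_{S_\infty}$): (i) (a) $\models^A A\land B$ iff $\models^A A$ and $\models^A B$; (b) $\models^A A\lor B$ iff $\models^A A$ or $\models^A B$; (c) $\models^A A\to B$ iff $\not\models^A A$ or $\models^A B$. (ii) (a) if $A$ is atomic, then $\not\models^V A$; (b) $\models^V A\land B$ iff $\models^V A$ and $\models^V B$; (c) $\models^V A\lor B$ iff $\models^V A$ or $\models^V B$; (d) $\models^V A\to B$ iff $\models^A A\to B$.
   Context: $\mathrm{NDE}$ is the set of closed terms generated from $\overline 0$ by a unary symbol $S$ and binary symbols $+$, $\cdot$; for $z\in\mathrm{NDE}$, $[\![z]\!]\in\mathbb N$ is the number it denotes under the standard interpretation. $\mathrm{Eq}=\{x=y: x,y\in\mathrm{NDE}\}$ is the set of formal equations. $\mathrm{ClForm}$ is generated from the atomic formulas, namely $\bot$ and the elements of $\mathrm{Eq}$, by $\land,\lor,\to$; $\neg A$ abbreviates $A\to\bot$. $S_\infty=\langle T,\le_T,M,E\rangle$ is the following rooted, finitely branching tree, all of whose branches are $\omega$-sequences, with $M:T\to\mathcal P(\mathrm{NDE})$ and $E:T\to\mathcal P(\mathrm{Eq})$. The root $t_0$ has $M(t_0)=\{\overline 0\}$, $E(t_0)=\emptyset$. The direct successors of a node $t$ are the following, for all $x,y\in M(t)$: (1) for $z$ each of $S(x)$, $x+y$, $x\cdot y$ with $z\notin M(t)$, a direct successor $t'$ with $M(t')=M(t)\cup\{z\}$,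 $E(t')=E(t)$; (2) if $[\![x]\!]=[\![y]\!]$ and $(x=y)\notin E(t)$, a direct successor $t'$ with $M(t')=M(t)$, $E(t')=E(t)\cup\{x=y\}$. Forcing: $t\models p$ iff $p\in E(t)$ for $p\in\mathrm{Eq}$; $t\not\models\bot$; $t\models A\land B$ iff $t\models A$ and $t\models B$; $t\models A\lor B$ iff $t\models A$ or $t\models B$; $t\models A\to B$ iff for every $t'\ge_T t$ with $t'\models A$ there is $t''\ge_T t'$ with $t''\models B$. $\models^V_{S_\infty}A$ (valid): $t\models A$ for all $t\in T$. $\models^A_{S_\infty}A$ (assertible): $t\models A$ for some $t\in T$. *)

theory Defs
  imports "HOL-Library.Sublist"
begin

datatype nde = Zero | Succ nde | Plus nde nde | Times nde nde

primrec denot :: "nde \<Rightarrow> nat" where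
  "denot Zero = 0"
| "denot (Succ x) = Suc (denot x)"
| "denot (Plus x y) = denot x + denot y"
| "denot (Times x y) = denot x * denot y"

datatype equation = Equation nde nde

datatype clform =
    Bot
  | Eq equation
  | And clform clform
  | Or clform clform
  | Imp clform clform

definition atomic :: "clform \<Rightarrow> bool" where
  "atomic A \<longleftrightarrow> A = Bot \<or> (\<exists>e. A = Eq e)"

record 'n tree_model =
  T :: "'n set"
  le :: "'n \<Rightarrow> 'n \<Rightarrow> bool"
  M :: "'n \<Rightarrow> nde set"
  E :: "'n \<Rightarrow> equation set"

primrec forces :: "'n tree_model \<Rightarrow> 'n \<Rightarrow> clform \<Rightarrow> bool" where
  "forces S t Bot \<longleftrightarrow> False"
| "forces S t (Eq e) \<longleftrightarrow> e \<in> E S t"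
| "forces S t (And A B) \<longleftrightarrow> forces S t A \<and> forces S t B"
| "forces S t (Or A B) \<longleftrightarrow> forces S t A \<or> forces S t B"
| "forces S t (Imp A B) \<longleftrightarrow>
    (\<forall>t' \<in> T S. le S t t' \<and> forces S t' A \<longrightarrow>
      (\<exists>t'' \<in> T S. le S t' t'' \<and> forces S t'' B))"

definition valid :: "'n tree_model \<Rightarrow> clform \<Rightarrow> bool" where
  "valid S A \<longleftrightarrow> (\<forall>t \<in> T S. forces S t A)"

definition assertible :: "'n tree_model \<Rightarrow> clform \<Rightarrow> bool" where
  "assertible S A \<longleftrightarrow> (\<exists>t \<in> T S. forces S t A)"

text \<open>
  A node of the tree is represented by the sequence of steps leading to it from the root
  \<^term>\<open>[]\<close>: a step either constructs a new term or adds a new equation. The labels of a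
  node are read off this sequence (see \<open>node_terms_snoc\<close> and \<open>node_eqs_snoc\<close> below for how
  they change from a node to its direct successors), and the tree order is the prefix order.
\<close>

datatype step = Construct nde | Add_Eq equation

definition node_terms :: "step list \<Rightarrow> nde set" where
  "node_terms t = insert Zero {z. Construct z \<in> set t}"

definition node_eqs :: "step list \<Rightarrow> equation set" where
  "node_eqs t = {e. Add_Eq e \<in> set t}"

inductive_set steps :: "nde set \<Rightarrow> equation set \<Rightarrow> step set" for X F where
  succ: "x \<in> X \<Longrightarrow> Succ x \<notin> X \<Longrightarrow> Construct (Succ x) \<in> steps X F"
| plus: "x \<in> X \<Longrightarrow> y \<in> X \<Longrightarrow> Plus x y \<notin> X \<Longrightarrow> Construct (Plus x y) \<in> steps X F"
| times: "x \<in> X \<Longrightarrow> y \<in> X \<Longrightarrow> Times x y \<notin> X \<Longrightarrow> Construct (Times x y) \<in> steps X F"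
| eq: "x \<in> X \<Longrightarrow> y \<in> X \<Longrightarrow> denot x = denot y \<Longrightarrow> Equation x y \<notin> F
    \<Longrightarrow> Add_Eq (Equation x y) \<in> steps X F"

inductive_set nodes :: "step list set" where
  root: "[] \<in> nodes"
| snoc: "t \<in> nodes \<Longrightarrow> s \<in> steps (node_terms t) (node_eqs t) \<Longrightarrow> t @ [s] \<in> nodes"

definition S_inf :: "step list tree_model" where
  "S_inf = \<lparr>T = nodes, le = prefix, M = node_terms, E = node_eqs\<rparr>"

lemma node_terms_root: "node_terms [] = {Zero}"
  and node_terms_snoc:
    "node_terms (t @ [Construct z]) = node_terms t \<union> {z}"
    "node_terms (t @ [Add_Eq e]) = node_terms t"
  by (auto simp: node_terms_def)

lemma node_eqs_root: "node_eqs [] = {}"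
  and node_eqs_snoc:
    "node_eqs (t @ [Construct z]) = node_eqs t"
    "node_eqs (t @ [Add_Eq e]) = node_eqs t \<union> {e}"
  by (auto simp: node_eqs_def)

lemma nodes_prefix_closed: "t' \<in> nodes \<Longrightarrow> prefix t t' \<Longrightarrow> t \<in> nodes"
  by (induction rule: nodes.induct) (auto intro: nodes.intros)

lemma finite_node_terms: "finite (node_terms t)"
proof -
  have "node_terms t \<subseteq> insert Zero ((\<lambda>s. case s of Construct z \<Rightarrow> z | _ \<Rightarrow> Zero) ` set t)"
    by (force simp: node_terms_def image_iff split: step.split)
  then show ?thesis
    by (rule finite_subset) simp
qed

lemma finitely_branching: "finite (steps (node_terms t) (node_eqs t))"
proof -
  let ?X = "node_terms t"
  have "steps ?X (node_eqs t) \<subseteq>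
      (Construct \<circ> Succ) ` ?X \<union> (\<lambda>(x, y). Construct (Plus x y)) ` (?X \<times> ?X)
      \<union> (\<lambda>(x, y). Construct (Times x y)) ` (?X \<times> ?X)
      \<union> (\<lambda>(x, y). Add_Eq (Equation x y)) ` (?X \<times> ?X)"
    by (auto elim!: steps.cases)
  then show ?thesis
    by (rule finite_subset) (simp add: finite_node_terms)
qed

lemma no_leaves: "\<exists>s. s \<in> steps (node_terms t) (node_eqs t)"
proof -
  let ?X = "node_terms t"
  have "Max (size ` ?X) \<in> size ` ?X"
  proof (rule Max_in)
    show "finite (size ` ?X)" by (simp add: finite_node_terms)
    show "size ` ?X \<noteq> {}" by (simp add: node_terms_def)
  qed
  then obtain x where x: "x \<in> ?X" and "size x = Max (size ` ?X)"
    by auto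
  then have max: "\<And>y. y \<in> ?X \<Longrightarrow> size y \<le> size x"
    by (simp add: finite_node_terms)
  have "Succ x \<notin> ?X"
    using max[of "Succ x"] by auto
  with x show ?thesis
    by (blast intro: steps.succ)
qed

end

theory Submission
  imports Defs
begin

text \<open>
  Call a formula true if it holds classically under the standard interpretation. From every node,
  any term can be constructed and then any true equation added further up the tree. Hence every
  node forces only true formulas, and every true formula is forced at some extension of any node.
  Assertibility is therefore classical truth. Implications are moreover forced at every node or at
  none, whereas in general validity is forcing at the root, by monotonicity.
\<close>

primrec true_std :: "clform \<Rightarrow> bool" where
  "true_std Bot \<longleftrightarrow> False"
| "true_std (Eq e) \<longleftrightarrow> (case e of Equation x y \<Rightarrow> denot x = denot y)"
| "true_std (And A B) \<longleftrightarrow> true_std A \<and> true_std B"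
| "true_std (Or A B) \<longleftrightarrow> true_std A \<or> true_std B"
| "true_std (Imp A B) \<longleftrightarrow> (true_std A \<longrightarrow> true_std B)"

lemma S_inf_simps [simp]:
  "T S_inf = nodes" "le S_inf = prefix" "E S_inf = node_eqs"
  by (simp_all add: S_inf_def)

lemma node_terms_mono: "prefix t t' \<Longrightarrow> node_terms t \<subseteq> node_terms t'"
  by (auto simp: node_terms_def prefix_def)

lemma node_eqs_mono: "prefix t t' \<Longrightarrow> node_eqs t \<subseteq> node_eqs t'"
  by (auto simp: node_eqs_def prefix_def)

text \<open>Labels only grow along the prefix order, which settles equations; the clause for
  implication already quantifies over all extensions, so there transitivity suffices.\<close>

lemma forces_mono: "forces S_inf t A \<Longrightarrow> prefix t t' \<Longrightarrow> forces S_inf t' A"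
proof (induction A)
  case (Eq e)
  then show ?case using node_eqs_mono by auto
next
  case (Imp A B)
  then show ?case by simp (meson prefix_order.trans)
qed auto

lemma node_eqs_denot:
  "t \<in> nodes \<Longrightarrow> Equation x y \<in> node_eqs t \<Longrightarrow> denot x = denot y"
  by (induction rule: nodes.induct) (auto simp: node_eqs_def elim: steps.cases)

text \<open>Construction steps apply only to terms not yet present. When \<open>z\<close> is already
  there, \<open>t\<close> itself serves as the extension.\<close>

lemma construct_extension:
  assumes "t \<in> nodes" and "z \<notin> node_terms t \<Longrightarrow> Construct z \<in> steps (node_terms t) (node_eqs t)"
  obtains t' where "t' \<in> nodes" "prefix t t'" "z \<in> node_terms t'"
proof (cases "z \<in> node_terms t")
  case True
  with assms(1) that[of t] show ?thesis by simp
next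
  case False
  with assms that[of "t @ [Construct z]"] show ?thesis
    by (simp add: nodes.snoc node_terms_snoc)
qed

text \<open>The node must be arbitrary in the induction: the second argument is built above the node
  that supplies the first, which persists by monotonicity.\<close>

lemma term_extension:
  "t \<in> nodes \<Longrightarrow> \<exists>t' \<in> nodes. prefix t t' \<and> z \<in> node_terms t'"
proof (induction z arbitrary: t)
  case Zero
  then show ?case by (auto simp: node_terms_def)
next
  case (Succ x)
  then obtain u where u: "u \<in> nodes" "prefix t u" "x \<in> node_terms u" by blast
  then obtain v where "v \<in> nodes" "prefix u v" "Succ x \<in> node_terms v"
    using construct_extension[of u "Succ x"] steps.succ by metis
  with u show ?case by (meson prefix_order.trans)
next
  case (Plus x y)
  then obtain u where u: "u \<in> nodes" "prefix t u" "x \<in> node_terms u" by blast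
  with Plus obtain v where v: "v \<in> nodes" "prefix u v" "y \<in> node_terms v" by blast
  then have "x \<in> node_terms v" using u node_terms_mono by blast
  with v obtain w where "w \<in> nodes" "prefix v w" "Plus x y \<in> node_terms w"
    using construct_extension[of v "Plus x y"] steps.plus by metis
  with u v show ?case by (meson prefix_order.trans)
next
  case (Times x y)
  then obtain u where u: "u \<in> nodes" "prefix t u" "x \<in> node_terms u" by blast
  with Times obtain v where v: "v \<in> nodes" "prefix u v" "y \<in> node_terms v" by blast
  then have "x \<in> node_terms v" using u node_terms_mono by blast
  with v obtain w where "w \<in> nodes" "prefix v w" "Times x y \<in> node_terms w"
    using construct_extension[of v "Times x y"] steps.times by metis
  with u v show ?case by (meson prefix_order.trans)
qed

lemma equation_extension:
  assumes "t \<in> nodes" and "denot x = denot y"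
  shows "\<exists>t' \<in> nodes. prefix t t' \<and> Equation x y \<in> node_eqs t'"
proof -
  obtain u where u: "u \<in> nodes" "prefix t u" "x \<in> node_terms u"
    using assms(1) term_extension by blast
  obtain v where v: "v \<in> nodes" "prefix u v" "y \<in> node_terms v"
    using u(1) term_extension by blast
  have "x \<in> node_terms v" using u v node_terms_mono by blast
  have tv: "prefix t v" using u v by (meson prefix_order.trans)
  show ?thesis
  proof (cases "Equation x y \<in> node_eqs v")
    case True
    with v tv show ?thesis by blast
  next
    case False
    with \<open>x \<in> node_terms v\<close> v assms(2)
    have "v @ [Add_Eq (Equation x y)] \<in> nodes"
      by (blast intro: nodes.snoc steps.eq)
    moreover have "prefix t (v @ [Add_Eq (Equation x y)])"
      using tv by simp
    ultimately show ?thesis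
      by (metis UnCI insertI1 node_eqs_snoc(2))
  qed
qed

text \<open>Soundness and density are proved together because, for an implication, each half needs
  soundness for one side and density for the other.\<close>

lemma forces_sound_and_dense:
  "(\<forall>t \<in> nodes. forces S_inf t A \<longrightarrow> true_std A) \<and>
   (true_std A \<longrightarrow> (\<forall>t \<in> nodes. \<exists>t' \<in> nodes. prefix t t' \<and> forces S_inf t' A))"
proof (induction A)
  case Bot
  then show ?case by simp
next
  case (Eq e)
  then show ?case
    by (cases e) (auto dest: node_eqs_denot equation_extension)
next
  case (And A B)
  show ?case
  proof (intro conjI impI ballI)
    fix t assume "t \<in> nodes" "forces S_inf t (And A B)"
    with And show "true_std (And A B)" by auto
  next
    fix t assume "true_std (And A B)" "t \<in> nodes"
    with And obtain u where u: "u \<in> nodes" "prefix t u" "forces S_inf u A" by auto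
    with And \<open>true_std (And A B)\<close> obtain v where v: "v \<in> nodes" "prefix u v" "forces S_inf v B"
      by auto
    have "forces S_inf v A" using u v forces_mono by blast
    with u v show "\<exists>t' \<in> nodes. prefix t t' \<and> forces S_inf t' (And A B)"
      by (auto intro: prefix_order.trans)
  qed
next
  case (Or A B)
  then show ?case by fastforce
next
  case (Imp A B)
  show ?case
  proof (intro conjI impI ballI)
    fix t assume "t \<in> nodes" "forces S_inf t (Imp A B)"
    \<comment> \<open>If \<open>A\<close> is true, density yields an extension of \<open>t\<close>
      forcing \<open>A\<close>; the implication then gives a later node forcing \<open>B\<close>,
      and soundness makes \<open>B\<close> true.\<close>
    with Imp show "true_std (Imp A B)" by simp blast
  next
    fix t assume "true_std (Imp A B)" "t \<in> nodes"
    with Imp have "forces S_inf t (Imp A B)" by auto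
    with \<open>t \<in> nodes\<close> show "\<exists>t' \<in> nodes. prefix t t' \<and> forces S_inf t' (Imp A B)" by blast
  qed
qed

lemma assertible_iff_true_std: "assertible S_inf A \<longleftrightarrow> true_std A"
  using forces_sound_and_dense[of A] nodes.root by (auto simp: assertible_def)

lemma forces_Imp_iff:
  assumes "t \<in> nodes"
  shows "forces S_inf t (Imp A B) \<longleftrightarrow> true_std (Imp A B)"
proof
  show "forces S_inf t (Imp A B) \<Longrightarrow> true_std (Imp A B)"
    using assms forces_sound_and_dense by blast
  show "true_std (Imp A B) \<Longrightarrow> forces S_inf t (Imp A B)"
    using forces_sound_and_dense[of A] forces_sound_and_dense[of B] by auto
qed

text \<open>The root is a prefix of every node, so forcing there persists everywhere. This lets
  validity split over disjunctions, since the root itself selects a disjunct.\<close>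

lemma valid_iff_forces_root: "valid S_inf A \<longleftrightarrow> forces S_inf [] A"
  using nodes.root forces_mono[of "[]" A] by (auto simp: valid_def)

theorem proposition5:
  fixes A B :: clform
  shows
    "(assertible S_inf (And A B) \<longleftrightarrow> assertible S_inf A \<and> assertible S_inf B) \<and>
     (assertible S_inf (Or A B) \<longleftrightarrow> assertible S_inf A \<or> assertible S_inf B) \<and>
     (assertible S_inf (Imp A B) \<longleftrightarrow> \<not> assertible S_inf A \<or> assertible S_inf B) \<and>
     (atomic A \<longrightarrow> \<not> valid S_inf A) \<and>
     (valid S_inf (And A B) \<longleftrightarrow> valid S_inf A \<and> valid S_inf B) \<and>
     (valid S_inf (Or A B) \<longleftrightarrow> valid S_inf A \<or> valid S_inf B) \<and>
     (valid S_inf (Imp A B) \<longleftrightarrow> assertible S_inf (Imp A B))"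
proof -
  have "atomic A \<longrightarrow> \<not> valid S_inf A"
    \<comment> \<open>The root carries no equations, so it forces no atomic formula.\<close>
    by (auto simp: atomic_def valid_iff_forces_root node_eqs_root)
  moreover have "valid S_inf (Imp A B) \<longleftrightarrow> assertible S_inf (Imp A B)"
    using forces_Imp_iff[OF nodes.root] by (simp only: valid_iff_forces_root assertible_iff_true_std)
  ultimately show ?thesis
    \<comment> \<open>The forcing clause for implication stays folded, so that the fact about
      \<open>Imp A B\<close> still matches the goal.\<close>
    by (auto simp: assertible_iff_true_std valid_iff_forces_root simp del: forces.simps(5))
qed

end
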